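(* Let $a,d,k$ be positive integers with $\gcd(a,d)=1$ and $2\le k\le a$. Put $a_j=a+(j-1)d$ for $1\le j\le k$, and let $q,r$ be the nonnegative integers with $a-1=q(k-1)+r$ and $0\le r<k-1$. For $\lambda\ne 0$ with $\lambda^d\ne 1$, $\lambda^a\ne 1$ and $\lambda^{a_k}\ne 1$, we have \begin{align*} &s^{(\lambda)}(a,a+d,\dots,a+(k-1)d)\\ &=\frac{1}{\lambda^{a}-1}\biggl(\frac{\lambda^d(\lambda^{q a_k}-\lambda^{a_k})}{\lambda^{a_k}-1}\left(\frac{a_k\lambda^{a_k}-a\lambda^a}{\lambda^d-1}-\frac{d(\lambda^{a_k}-\lambda^a)}{(\lambda^d-1)^2}\right)\\ &\qquad +\frac{\lambda^d(\lambda^{a_k}-\lambda^a)}{\lambda^d-1}\left(\frac{q a_k\lambda^{q a_k}}{\lambda^{a_k}-1}-\frac{a_k\lambda^{a_k}(\lambda^{q a_k}-1)}{(\lambda^{a_k}-1)^2}\right)\\ &\qquad +\lambda^{q a_k+d}\left(\frac{a_{r+1}\lambda^{a_{r+1}}-a\lambda^a}{\lambda^d-1}-\frac{d(\lambda^{a_{r+1}}-\lambda^a)}{(\lambda^d-1)^2}\right)\\ &\qquad +q a_k\lambda^{q a_k+d}\,\frac{\lambda^{a_{r+1}}-\lambda^a}{\lambda^d-1}\biggr)\\ &\quad -\frac{a\lambda^{a}}{(\lambda^{a}-1)^2}\biggl(1+\frac{\lambda^d(\lambda^{a_k}-\lambda^a)}{\lambda^d-1}\cdot\frac{\lambda^{q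 a_k}-1}{\lambda^{a_k}-1} +\frac{\lambda^{q a_k+d}(\lambda^{a_{r+1}}-\lambda^a)}{\lambda^d-1}\biggr)\\ &\quad +\frac{\lambda}{(\lambda-1)^2}. \end{align*}
   Context: For positive integers $b_1,\dots,b_m$ with $\gcd(b_1,\dots,b_m)=1$, let $\mathrm{NR}(b_1,\dots,b_m)$ denote the (finite) set of positive integers that cannot be written as $x_1b_1+\cdots+x_mb_m$ with nonnegative integers $x_1,\dots,x_m$. For a (real or complex) number $\lambda$, the Sylvester weighted sum is $s^{(\lambda)}(b_1,\dots,b_m)=\sum_{n\in \mathrm{NR}(b_1,\dots,b_m)}\lambda^n n$.
   Formalization: The first numerator λ^{q a_k} − λ^{a_k} is corrected to λ^{q a_k} − 1; as printed the formula fails, e.g. for a=2, d=1, k=2, λ=2 it gives −6 while the sum is 2. *)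

theory Defs
  imports Complex_Main
begin

definition nonrepresentable :: "nat list \<Rightarrow> nat set" where
  "nonrepresentable bs =
     {n. 0 < n \<and> \<not> (\<exists>x :: nat \<Rightarrow> nat. n = (\<Sum>i<length bs. x i * bs ! i))}"

(* Only meaningful when the generators have gcd 1: then the index set is finite,
   whereas a sum over an infinite set would be 0 by convention. *)
definition sylvester_weighted_sum :: "'a::comm_semiring_1 \<Rightarrow> nat list \<Rightarrow> 'a" where
  "sylvester_weighted_sum \<mu> bs = (\<Sum>n\<in>nonrepresentable bs. \<mu> ^ n * of_nat n)"

end

theory Submission
  imports Defs "HOL-Number_Theory.Cong"
begin

text \<open>
  Let \<open>m\<^sub>j\<close> be the least representable number congruent to \<open>jd\<close> modulo \<open>a\<close>, for \<open>0 \<le> j < a\<close>. The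
  nonrepresentable numbers are exactly those lying below \<open>m\<^sub>j\<close> in its residue class, so summing
  \<open>\<mu>\<^sup>n n\<close> over each class (an arithmetic progression of difference \<open>a\<close>) expresses the Sylvester
  sum through \<open>\<Sum> \<mu>\<^sup>m\<close> and \<open>\<Sum> m \<mu>\<^sup>m\<close> over the Apery set \<open>{m\<^sub>j}\<close>. A sum of \<open>s\<close> generators is \<open>sa + td\<close>
  with \<open>0 \<le> t \<le> s(k - 1)\<close> arbitrary, whence \<open>m\<^sub>j = \<lceil>j / (k - 1)\<rceil> a + jd\<close>; writing
  \<open>j = i(k - 1) + s + 1\<close> splits the Apery set into arithmetic progressions of difference \<open>d\<close>.
\<close>

section \<open>Power sums over arithmetic progressions\<close>

lemma sum_powers_progression:
  fixes \<mu> :: "'a::field"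
  assumes "\<mu> ^ b \<noteq> 1"
  shows "(\<Sum>i<n. \<mu> ^ (c + i * b)) = (\<mu> ^ (c + n * b) - \<mu> ^ c) / (\<mu> ^ b - 1)"
proof (induction n)
  case (Suc n)
  with assms show ?case
    by (simp add: field_simps power_add)
qed simp

lemma sum_weighted_powers_progression:
  fixes \<mu> :: "'a::field"
  assumes "\<mu> ^ b \<noteq> 1"
  shows "(\<Sum>i<n. \<mu> ^ (c + i * b) * of_nat (c + i * b)) =
    (of_nat (c + n * b) * \<mu> ^ (c + n * b) - of_nat c * \<mu> ^ c) / (\<mu> ^ b - 1)
      - of_nat b * \<mu> ^ b * (\<mu> ^ (c + n * b) - \<mu> ^ c) / (\<mu> ^ b - 1)\<^sup>2"
proof (induction n)
  case (Suc n)
  \<comment> \<open>The closed form is an antidifference of the summand. Here \<open>x\<close>,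
    \<open>y\<close>, \<open>z\<close>, \<open>w\<close> stand for
    \<open>\<mu> ^ (c + n * b)\<close>, \<open>\<mu> ^ b\<close>, \<open>c + n * b\<close>,
    \<open>b\<close>; the values \<open>u\<close>, \<open>v\<close> at the start drop out.\<close>
  have telescope: "x * z = ((z + w) * (x * y) - v) / (y - 1) - w * y * (x * y - u) / (y - 1)\<^sup>2
      - ((z * x - v) / (y - 1) - w * y * (x - u) / (y - 1)\<^sup>2)"
    if "y \<noteq> 1" for x y z u v w :: 'a
    using that by (simp add: divide_simps) (simp add: algebra_simps power2_eq_square)
  have next_term: "\<mu> ^ (c + Suc n * b) = \<mu> ^ (c + n * b) * \<mu> ^ b"
    "of_nat (c + Suc n * b) = of_nat (c + n * b) + (of_nat b :: 'a)"
    by (simp_all add: power_add algebra_simps)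
  show ?case
    unfolding sum.lessThan_Suc Suc next_term
    by (subst telescope[OF assms, of _ _ "of_nat b" "of_nat c * \<mu> ^ c" "\<mu> ^ c"]) simp
qed simp

text \<open>With \<open>G\<close> an antidifference of \<open>\<mu> ^ n * n\<close> for the step
  \<open>a\<close>, each class contributes \<open>G (m j) - G (m j mod a)\<close>. The lower ends
  \<open>m j mod a\<close> run through all residues, so their total is independent of
  \<open>m\<close>; it gives the last summand.\<close>

lemma sum_weighted_powers_below_Apery:
  fixes \<mu> :: "'a::field" and m :: "'b \<Rightarrow> nat"
  assumes "0 < a" and "\<mu> ^ a \<noteq> 1"
    and residues: "bij_betw (\<lambda>j. m j mod a) J {..<a}"
    and gaps: "\<And>j n. j \<in> J \<Longrightarrow> n mod a = m j mod a \<Longrightarrow> n \<in> N \<longleftrightarrow> 0 < n \<and> n < m j"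
  shows "(\<Sum>n\<in>N. \<mu> ^ n * of_nat n) =
    (\<Sum>j\<in>J. \<mu> ^ m j * of_nat (m j)) / (\<mu> ^ a - 1)
      - of_nat a * \<mu> ^ a / (\<mu> ^ a - 1)\<^sup>2 * (\<Sum>j\<in>J. \<mu> ^ m j) + \<mu> / (\<mu> - 1)\<^sup>2"
proof -
  let ?w = "\<lambda>n. \<mu> ^ n * of_nat n :: 'a"
  define G where "G n = ?w n / (\<mu> ^ a - 1) - of_nat a * \<mu> ^ a / (\<mu> ^ a - 1)\<^sup>2 * \<mu> ^ n" for n
  define B where "B = (SIGMA j:J. {..<m j div a})"
  \<comment> \<open>Element number \<open>i\<close>, counted from the least residue, of the class of
    \<open>m j\<close>.\<close>
  define h where "h p = m (fst p) mod a + snd p * a" for p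
  have fin: "finite J"
    using residues bij_betw_finite by blast
  have "\<mu> \<noteq> 1"
    using assms(2) by auto
  have h_mod: "h (j, i) mod a = m j mod a" and h_div: "h (j, i) div a = i" for j i
    using \<open>0 < a\<close> by (simp_all add: h_def)
  have inj: "inj_on h B"
  proof (rule inj_onI)
    fix p p' assume B: "p \<in> B" "p' \<in> B" and eq: "h p = h p'"
    obtain j i j' i' where p: "p = (j, i)" "p' = (j', i')" "j \<in> J" "j' \<in> J"
      using B by (auto simp: B_def)
    then have "m j mod a = m j' mod a"
      using eq h_mod by metis
    then have "j = j'"
      using residues p by (auto simp: bij_betw_def dest: inj_onD)
    moreover have "i = i'"
      using eq h_div p by metis
    ultimately show "p = p'"
      by (simp add: p)
  qed
  have class_of: "\<exists>j\<in>J. m j mod a = n mod a" for n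
  proof -
    have "n mod a \<in> (\<lambda>j. m j mod a) ` J"
      using residues \<open>0 < a\<close> by (simp add: bij_betw_def)
    then show ?thesis
      by force
  qed
  have h_less: "h (j, i) < m j" if "i < m j div a" for j i
  proof -
    have "i * a < m j div a * a"
      using that \<open>0 < a\<close> by simp
    then show ?thesis
      using div_mult_mod_eq[of "m j" a] unfolding h_def fst_conv snd_conv by linarith
  qed
  have "0 \<notin> N"
    using class_of[of 0] gaps by (metis less_irrefl)
  \<comment> \<open>\<open>h\<close> hits 0 when the representative of the class of 0 is positive,
    but the weight at 0 vanishes.\<close>
  have N: "N = h ` B - {0}"
  proof (intro set_eqI iffI)
    fix n assume "n \<in> h ` B - {0}"
    then obtain j i where "j \<in> J" "i < m j div a" "n = h (j, i)" "n \<noteq> 0"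
      by (auto simp: B_def)
    then show "n \<in> N"
      using gaps[of j n] h_mod[of j i] h_less[of i j] by simp
  next
    fix n assume "n \<in> N"
    obtain j where j: "j \<in> J" "m j mod a = n mod a"
      using class_of by blast
    then have "n < m j"
      using gaps[of j n] \<open>n \<in> N\<close> by simp
    then have "n div a * a < m j div a * a"
      using div_mult_mod_eq[of n a] div_mult_mod_eq[of "m j" a] j(2) by linarith
    then have "n div a < m j div a"
      by simp
    then have "(j, n div a) \<in> B"
      using j by (simp add: B_def)
    moreover have "n = h (j, n div a)"
      using j by (simp add: h_def)
    ultimately have "n \<in> h ` B"
      by (rule rev_image_eqI)
    then show "n \<in> h ` B - {0}"
      using \<open>n \<in> N\<close> \<open>0 \<notin> N\<close> by blast
  qed
  have "finite (h ` B)"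
    using fin by (simp add: B_def)
  then have "sum ?w N = sum ?w (h ` B)"
    unfolding N by (intro sum.mono_neutral_left) auto
  also have "\<dots> = (\<Sum>j\<in>J. \<Sum>i<m j div a. ?w (m j mod a + i * a))"
    unfolding sum.reindex[OF inj] using fin by (simp add: B_def sum.Sigma h_def case_prod_unfold)
  also have "\<dots> = (\<Sum>j\<in>J. G (m j) - G (m j mod a))"
    unfolding sum_weighted_powers_progression[OF assms(2)] mod_div_mult_eq
    by (intro sum.cong refl) (simp add: G_def algebra_simps diff_divide_distrib)
  also have "\<dots> = (\<Sum>j\<in>J. G (m j)) - (\<Sum>c<a. G c)"
    using sum.reindex_bij_betw[OF residues, of G] by (simp add: sum_subtractf)
  also have "(\<Sum>j\<in>J. G (m j)) = sum (?w \<circ> m) J / (\<mu> ^ a - 1)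
      - of_nat a * \<mu> ^ a / (\<mu> ^ a - 1)\<^sup>2 * (\<Sum>j\<in>J. \<mu> ^ m j)"
    by (simp add: G_def sum_subtractf sum_divide_distrib sum_distrib_left)
  also have "(\<Sum>c<a. G c) = - \<mu> / (\<mu> - 1)\<^sup>2"
  proof -
    have G: "(\<Sum>c<a. G c) = (\<Sum>c<a. ?w c) / (\<mu> ^ a - 1)
        - of_nat a * \<mu> ^ a / (\<mu> ^ a - 1)\<^sup>2 * (\<Sum>c<a. \<mu> ^ c)"
      by (simp add: G_def sum_subtractf sum_divide_distrib sum_distrib_left)
    \<comment> \<open>Here \<open>y\<close> is \<open>\<mu> ^ a\<close>, \<open>z\<close> is
      \<open>\<mu> - 1\<close> and \<open>n\<close> is \<open>a\<close>; the two terms containing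
      \<open>n\<close> cancel.\<close>
    have cancel: "(n * y / z - x * (y - 1) / z\<^sup>2) / (y - 1) - n * y / (y - 1)\<^sup>2 * ((y - 1) / z)
        = - x / z\<^sup>2" if "y \<noteq> 1" "z \<noteq> 0" for n x y z :: 'a
      using that by (simp add: divide_simps power2_eq_square)
    show ?thesis
      unfolding G
      using sum_powers_progression[of \<mu> 1 0 a] sum_weighted_powers_progression[of \<mu> 1 0 a]
        cancel[of "\<mu> ^ a" "\<mu> - 1" "of_nat a" \<mu>] \<open>\<mu> \<noteq> 1\<close> assms(2)
      by simp
  qed
  finally show ?thesis
    by (simp add: comp_def)
qed

section \<open>The Apery set of an arithmetic progression\<close>

text \<open>\<open>s\<close> counts the summands with multiplicity, \<open>t\<close> adds up their
  indices \<open>i \<le> K\<close>.\<close>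

lemma arithmetic_progression_combination_iff:
  fixes a d K n :: nat
  shows "(\<exists>x :: nat \<Rightarrow> nat. n = (\<Sum>i<Suc K. x i * (a + i * d))) \<longleftrightarrow>
    (\<exists>s t. t \<le> s * K \<and> n = s * a + t * d)"
proof
  assume "\<exists>x :: nat \<Rightarrow> nat. n = (\<Sum>i<Suc K. x i * (a + i * d))"
  then obtain x :: "nat \<Rightarrow> nat" where "n = (\<Sum>i<Suc K. x i * (a + i * d))" ..
  then have "n = (\<Sum>i<Suc K. x i) * a + (\<Sum>i<Suc K. x i * i) * d"
    unfolding sum_distrib_right sum.distrib[symmetric] by (simp add: algebra_simps)
  moreover have "(\<Sum>i<Suc K. x i * i) \<le> (\<Sum>i<Suc K. x i) * K"
    unfolding sum_distrib_right by (intro sum_mono) auto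
  ultimately show "\<exists>s t. t \<le> s * K \<and> n = s * a + t * d"
    by blast
next
  assume "\<exists>s t. t \<le> s * K \<and> n = s * a + t * d"
  then obtain s t where "t \<le> s * K" "n = s * a + t * d"
    by blast
  then show "\<exists>x :: nat \<Rightarrow> nat. n = (\<Sum>i<Suc K. x i * (a + i * d))"
  proof (induction s arbitrary: t n)
    case 0
    then show ?case
      by (intro exI[of _ "\<lambda>_. 0"]) simp
  next
    case (Suc s)
    \<comment> \<open>Greedy choice: one generator takes as much of \<open>t\<close> as an index
      allows, so at most \<open>s * K\<close> is left for the other \<open>s\<close>.\<close>
    define i where "i = min t K"
    have t: "t = i + (t - i)" "t - i \<le> s * K" and "i < Suc K"
      using Suc.prems(1) by (auto simp: i_def)
    then obtain x :: "nat \<Rightarrow> nat"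
      where x: "s * a + (t - i) * d = (\<Sum>l<Suc K. x l * (a + l * d))"
      using Suc.IH by blast
    have "t * d = i * d + (t - i) * d"
      using t(1) by (metis add_mult_distrib)
    then have "n = (\<Sum>l<Suc K. x l * (a + l * d)) + (a + i * d)"
      unfolding x[symmetric] Suc.prems(2) by simp
    also have "a + i * d = (\<Sum>l<Suc K. if l = i then a + l * d else 0)"
      using \<open>i < Suc K\<close> by (subst sum.delta) auto
    also have "(\<Sum>l<Suc K. x l * (a + l * d)) + \<dots> =
        (\<Sum>l<Suc K. (x l + of_bool (l = i)) * (a + l * d))"
      unfolding sum.distrib[symmetric] by (intro sum.cong) (auto simp: algebra_simps)
    finally show ?case
      by (intro exI[of _ "\<lambda>l. x l + of_bool (l = i)"])
  qed
qed

lemma nonrepresentable_arithmetic_progression: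
  "nonrepresentable (map (\<lambda>i. a + i * d) [0..<Suc K]) =
    {n. 0 < n \<and> \<not> (\<exists>s t. t \<le> s * K \<and> n = s * a + t * d)}"
  unfolding nonrepresentable_def arithmetic_progression_combination_iff[symmetric]
  by (simp del: upt_Suc sum.lessThan_Suc)

text \<open>The natural number \<open>(j + K - 1) div K\<close> is \<open>\<lceil>j / K\<rceil>\<close> for \<open>K > 0\<close>.\<close>

definition Apery_element :: "nat \<Rightarrow> nat \<Rightarrow> nat \<Rightarrow> nat \<Rightarrow> nat" where
  "Apery_element a d K j = (j + K - 1) div K * a + j * d"

lemma ceiling_div_le_iff:
  fixes j K s :: nat
  assumes "0 < K"
  shows "(j + K - 1) div K \<le> s \<longleftrightarrow> j \<le> s * K"
proof -
  have "(j + K - 1) div K \<le> s \<longleftrightarrow> (j + K - 1) div K < Suc s"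
    by auto
  also have "\<dots> \<longleftrightarrow> j + K - 1 < Suc s * K"
    using assms by (simp add: div_less_iff_less_mult)
  finally show ?thesis
    using assms by auto
qed

text \<open>Modulo \<open>a\<close> only \<open>j * d\<close> survives, and \<open>d\<close> is
  invertible.\<close>

lemma bij_betw_Apery_element_mod:
  assumes "0 < a" and "coprime a d"
  shows "bij_betw (\<lambda>j. Apery_element a d K j mod a) {..<a} {..<a}"
proof -
  have "inj_on (\<lambda>j. Apery_element a d K j mod a) {..<a}"
  proof (rule inj_onI)
    fix i j assume "i \<in> {..<a}" "j \<in> {..<a}"
      and "Apery_element a d K i mod a = Apery_element a d K j mod a"
    then have "[i * d = j * d] (mod a)"
      by (simp add: Apery_element_def cong_def)
    then have "[i = j] (mod a)"
      using assms by (simp add: cong_mult_rcancel_nat coprime_commute)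
    then show "i = j"
      using \<open>i \<in> {..<a}\<close> \<open>j \<in> {..<a}\<close> by (simp add: cong_def)
  qed
  moreover have "(\<lambda>j. Apery_element a d K j mod a) ` {..<a} \<subseteq> {..<a}"
    using \<open>0 < a\<close> by auto
  ultimately show ?thesis
    by (simp add: bij_betw_def endo_inj_surj)
qed

text \<open>Coprimality makes \<open>t\<close> congruent to \<open>j\<close>, and
  \<open>j < a\<close> then gives \<open>j \<le> t \<le> s * K\<close>, so both coefficients
  dominate. Conversely, the surplus over the Apery element is a multiple of \<open>a\<close>, paid
  by copies of the generator \<open>a\<close>, which leave \<open>t\<close> unchanged.\<close>

lemma combination_iff_Apery_element_le:
  assumes "0 < K" and "coprime a d" and "j < a"
    and "n mod a = Apery_element a d K j mod a"
  shows "(\<exists>s t. t \<le> s * K \<and> n = s * a + t * d) \<longleftrightarrow> Apery_element a d K j \<le> n"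
proof
  assume "\<exists>s t. t \<le> s * K \<and> n = s * a + t * d"
  then obtain s t where st: "t \<le> s * K" "n = s * a + t * d"
    by blast
  then have "[t * d = j * d] (mod a)"
    using assms(4) by (simp add: Apery_element_def cong_def)
  then have "[t = j] (mod a)"
    using assms(2) by (simp add: cong_mult_rcancel_nat coprime_commute)
  then have "j \<le> t"
    using \<open>j < a\<close> by (metis cong_def mod_less mod_less_eq_dividend)
  then show "Apery_element a d K j \<le> n"
    unfolding st(2) Apery_element_def
    using st(1) ceiling_div_le_iff[OF \<open>0 < K\<close>] by (intro add_mono mult_right_mono) auto
next
  assume "Apery_element a d K j \<le> n"
  then obtain u where "n = Apery_element a d K j + u * a"
    using assms(4) by (metis le_add_diff_inverse mod_eq_dvd_iff_nat dvd_div_mult_self)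
  then have "n = ((j + K - 1) div K + u) * a + j * d"
    by (simp add: Apery_element_def algebra_simps)
  moreover have "j \<le> ((j + K - 1) div K + u) * K"
    using ceiling_div_le_iff[OF \<open>0 < K\<close>] le_add1 by blast
  ultimately show "\<exists>s t. t \<le> s * K \<and> n = s * a + t * d"
    by blast
qed

text \<open>Past \<open>j = 0\<close> the ceiling is constant on blocks of \<open>K\<close>
  consecutive indices: \<open>q\<close> full blocks and a last one of length \<open>r\<close>. A
  general \<open>f\<close> serves both the plain and the weighted sum.\<close>

lemma sum_Apery_elements:
  fixes f :: "nat \<Rightarrow> 'a::comm_monoid_add"
  assumes "0 < K" and "r < K"
  shows "(\<Sum>j<Suc (q * K + r). f (Apery_element a d K j)) =
    f 0 + ((\<Sum>i<q. \<Sum>s<K. f (i * (a + K * d) + (a + d + s * d)))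
         + (\<Sum>s<r. f (q * (a + K * d) + (a + d + s * d))))"
proof -
  let ?g = "\<lambda>j. f (Apery_element a d K (Suc j))"
  have elem: "Apery_element a d K (Suc (i * K + s)) = i * (a + K * d) + (a + d + s * d)"
    if "s < K" for i s
  proof -
    \<comment> \<open>Because \<open>i * K < i * K + s + 1 \<le> (i + 1) * K\<close>.\<close>
    have "(Suc (i * K + s) + K - 1) div K = Suc i"
      using that by (simp add: div_nat_eqI algebra_simps)
    then show ?thesis
      by (simp add: Apery_element_def algebra_simps)
  qed
  have "(\<Sum>j<q * K + r. ?g j) = (\<Sum>j<q * K. ?g j) + (\<Sum>s<r. ?g (q * K + s))"
    by (induction r) (simp_all add: add.assoc)
  also have "(\<Sum>j<q * K. ?g j) = (\<Sum>i<q. \<Sum>s<K. ?g (i * K + s))"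
  proof (induction q)
    case (Suc q)
    have "(\<Sum>j<q * K + K'. ?g j) = (\<Sum>j<q * K. ?g j) + (\<Sum>s<K'. ?g (q * K + s))" for K'
      by (induction K') (simp_all add: add.assoc)
    with Suc show ?case
      by (simp add: add.commute[of K])
  qed simp
  also have "(\<Sum>i<q. \<Sum>s<K. ?g (i * K + s)) =
      (\<Sum>i<q. \<Sum>s<K. f (i * (a + K * d) + (a + d + s * d)))"
    by (intro sum.cong refl) (simp add: elem)
  also have "(\<Sum>s<r. ?g (q * K + s)) = (\<Sum>s<r. f (q * (a + K * d) + (a + d + s * d)))"
    using \<open>r < K\<close> by (intro sum.cong refl) (simp add: elem)
  moreover have "Apery_element a d K 0 = 0"
    using \<open>0 < K\<close> by (simp add: Apery_element_def)
  ultimately show ?thesis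
    by (simp only: sum.lessThan_Suc_shift)
qed

text \<open>The first numerator \<open>\<mu> ^ (q * A k) - 1\<close> comes from the sum of
  \<open>\<mu> ^ (i * A k)\<close> over \<open>i < q\<close>. The English formula has
  \<open>\<mu> ^ A k\<close> in place of 1 there and fails for the generators 2, 3 with
  \<open>\<mu> = 2\<close>: it gives -6 instead of 2.\<close>

theorem theorem3:
  fixes a d k q r :: nat and A :: "nat \<Rightarrow> nat" and \<mu> :: complex
  assumes "0 < a" and "0 < d" and "0 < k"
    and "gcd a d = 1"
    and "2 \<le> k" and "k \<le> a"
    and "\<And>j. 1 \<le> j \<Longrightarrow> j \<le> k \<Longrightarrow> A j = a + (j - 1) * d"
    and "a - 1 = q * (k - 1) + r" and "r < k - 1"
    and "\<mu> \<noteq> 0" and "\<mu> ^ d \<noteq> 1" and "\<mu> ^ a \<noteq> 1" and "\<mu> ^ A k \<noteq> 1"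
  shows
    "sylvester_weighted_sum \<mu> (map (\<lambda>i. a + i * d) [0..<k]) =
       1 / (\<mu> ^ a - 1) *
         (\<mu> ^ d * (\<mu> ^ (q * A k) - 1) / (\<mu> ^ A k - 1)
            * ((of_nat (A k) * \<mu> ^ A k - of_nat a * \<mu> ^ a) / (\<mu> ^ d - 1)
               - of_nat d * (\<mu> ^ A k - \<mu> ^ a) / (\<mu> ^ d - 1)\<^sup>2)
          + \<mu> ^ d * (\<mu> ^ A k - \<mu> ^ a) / (\<mu> ^ d - 1)
            * (of_nat (q * A k) * \<mu> ^ (q * A k) / (\<mu> ^ A k - 1)
               - of_nat (A k) * \<mu> ^ A k * (\<mu> ^ (q * A k) - 1) / (\<mu> ^ A k - 1)\<^sup>2)
          + \<mu> ^ (q * A k + d)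
            * ((of_nat (A (r + 1)) * \<mu> ^ A (r + 1) - of_nat a * \<mu> ^ a) / (\<mu> ^ d - 1)
               - of_nat d * (\<mu> ^ A (r + 1) - \<mu> ^ a) / (\<mu> ^ d - 1)\<^sup>2)
          + of_nat (q * A k) * \<mu> ^ (q * A k + d)
            * ((\<mu> ^ A (r + 1) - \<mu> ^ a) / (\<mu> ^ d - 1)))
       - of_nat a * \<mu> ^ a / (\<mu> ^ a - 1)\<^sup>2
         * (1 + \<mu> ^ d * (\<mu> ^ A k - \<mu> ^ a) / (\<mu> ^ d - 1)
                * ((\<mu> ^ (q * A k) - 1) / (\<mu> ^ A k - 1))
              + \<mu> ^ (q * A k + d) * (\<mu> ^ A (r + 1) - \<mu> ^ a) / (\<mu> ^ d - 1))
       + \<mu> / (\<mu> - 1)\<^sup>2"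
proof -
  define K where "K = k - 1"
  have k: "k = Suc K" and "0 < K" and "r < K" and a: "a = Suc (q * K + r)"
    using assms by (auto simp: K_def)
  have Ak: "A k = a + K * d" and Ar: "A (r + 1) = a + r * d"
    using assms(7)[of k] assms(7)[of "r + 1"] assms(5,9) by (auto simp: K_def)
  have "coprime a d"
    using assms(4) by (simp add: coprime_iff_gcd_eq_1)
  let ?w = "\<lambda>n. \<mu> ^ n * of_nat n"
  define m where "m = Apery_element a d K"
  \<comment> \<open>\<open>P n\<close> and \<open>W n\<close> are the plain and weighted sums over
    the first \<open>n\<close> terms of a block. Pulling out \<open>\<mu> ^ d\<close> makes the end
    points \<open>a\<close> and \<open>a + n * d\<close>, the latter being \<open>A k\<close> for
    \<open>n = K\<close> and \<open>A (r + 1)\<close> for \<open>n = r\<close>.\<close>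
  define P where "P n = \<mu> ^ d * (\<mu> ^ (a + n * d) - \<mu> ^ a) / (\<mu> ^ d - 1)" for n
  define W where "W n = \<mu> ^ d
      * ((of_nat (a + n * d) * \<mu> ^ (a + n * d) - of_nat a * \<mu> ^ a) / (\<mu> ^ d - 1)
         - of_nat d * (\<mu> ^ (a + n * d) - \<mu> ^ a) / (\<mu> ^ d - 1)\<^sup>2)" for n
  have P: "(\<Sum>s<n. \<mu> ^ (a + d + s * d)) = P n" for n
    using sum_powers_progression[OF assms(11), of "a + d" n]
    by (simp add: P_def power_add algebra_simps)
  have W: "(\<Sum>s<n. ?w (a + d + s * d)) = W n" for n
  proof -
    \<comment> \<open>The extra \<open>z\<close> in both weights lowers the correction term by one
      factor \<open>y\<close>.\<close>
    have shift: "((u + z) * (y * x) - (v + z) * (y * x')) / (y - 1)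
          - z * y * (y * x - y * x') / (y - 1)\<^sup>2
        = y * ((u * x - v * x') / (y - 1) - z * (x - x') / (y - 1)\<^sup>2)"
      if "y \<noteq> 1" for u v x x' y z :: complex
      using that by (simp add: divide_simps power2_eq_square) (simp add: algebra_simps)
    have split: "\<mu> ^ (a + d + n * d) = \<mu> ^ d * \<mu> ^ (a + n * d)" "\<mu> ^ (a + d) = \<mu> ^ d * \<mu> ^ a"
      "of_nat (a + d + n * d) = of_nat (a + n * d) + (of_nat d :: complex)"
      by (simp_all add: power_add)
    show ?thesis
      unfolding sum_weighted_powers_progression[OF assms(11)] W_def split of_nat_add[of a d]
      by (rule shift[OF assms(11)])
  qed
  \<comment> \<open>Plain and weighted sums over the block offsets \<open>i * A k\<close>.\<close>
  define E where "E = (\<mu> ^ (q * A k) - 1) / (\<mu> ^ A k - 1)"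
  define F where "F = of_nat (q * A k) * \<mu> ^ (q * A k) / (\<mu> ^ A k - 1)
      - of_nat (A k) * \<mu> ^ A k * (\<mu> ^ (q * A k) - 1) / (\<mu> ^ A k - 1)\<^sup>2"
  have E: "(\<Sum>i<q. \<mu> ^ (i * A k)) = E"
    using sum_powers_progression[OF assms(13), of 0 q] by (simp add: E_def)
  have F: "(\<Sum>i<q. ?w (i * A k)) = F"
    using sum_weighted_powers_progression[OF assms(13), of 0 q] by (simp add: F_def)
  have powers: "(\<Sum>s<n. \<mu> ^ (c + (a + d + s * d))) = \<mu> ^ c * P n" for c n
    unfolding P[symmetric] sum_distrib_left by (simp add: power_add)
  have weights: "(\<Sum>s<n. ?w (c + (a + d + s * d))) = \<mu> ^ c * W n + ?w c * P n" for c n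
    unfolding P[symmetric] W[symmetric] sum_distrib_left sum.distrib[symmetric]
    by (simp add: power_add algebra_simps)
  have sum_m: "(\<Sum>j<a. \<mu> ^ m j) = 1 + (E * P K + \<mu> ^ (q * A k) * P r)"
    using sum_Apery_elements[OF \<open>0 < K\<close> \<open>r < K\<close>, of "\<lambda>n. \<mu> ^ n" a d q]
    unfolding a[symmetric] m_def powers Ak[symmetric] E[symmetric] by (simp add: sum_distrib_right)
  \<comment> \<open>The four products become the four summands of the large bracket. The index
    \<open>j = 0\<close> contributes 1 to the plain sum and 0 here.\<close>
  have sum_wm: "(\<Sum>j<a. ?w (m j)) =
      (E * W K + F * P K) + (\<mu> ^ (q * A k) * W r + ?w (q * A k) * P r)"
    using sum_Apery_elements[OF \<open>0 < K\<close> \<open>r < K\<close>, of ?w a d q]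
    unfolding a[symmetric] m_def weights Ak[symmetric] E[symmetric] F[symmetric]
    by (simp add: sum_distrib_right sum.distrib)
  have gaps: "n \<in> nonrepresentable (map (\<lambda>i. a + i * d) [0..<k]) \<longleftrightarrow> 0 < n \<and> n < m j"
    if "j \<in> {..<a}" "n mod a = m j mod a" for j n
    using combination_iff_Apery_element_le[OF \<open>0 < K\<close> \<open>coprime a d\<close>, of j n] that
    unfolding k nonrepresentable_arithmetic_progression m_def by auto
  have "sylvester_weighted_sum \<mu> (map (\<lambda>i. a + i * d) [0..<k]) =
      (\<Sum>j<a. ?w (m j)) / (\<mu> ^ a - 1)
      - of_nat a * \<mu> ^ a / (\<mu> ^ a - 1)\<^sup>2 * (\<Sum>j<a. \<mu> ^ m j) + \<mu> / (\<mu> - 1)\<^sup>2"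
    unfolding sylvester_weighted_sum_def
    using assms(1,12) bij_betw_Apery_element_mod[OF assms(1) \<open>coprime a d\<close>] gaps
    by (intro sum_weighted_powers_below_Apery) (auto simp: m_def)
  then show ?thesis
    unfolding sum_m sum_wm E_def F_def P_def W_def Ak[symmetric] Ar[symmetric]
    by (simp add: power_add mult.assoc mult.left_commute mult.commute add.assoc)
qed

end
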